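(* Let $\mathbf{A}\in\mathbb{C}^{m\times n}$ and $\mathbf{B}\in\mathbb{C}^{m\times s}$, and let $\mathbf{X}_{LS}=(x_{ij})\in\mathbb{C}^{n\times s}$ be the least squares solution with minimum norm of the matrix equation $\mathbf{A}\mathbf{X}=\mathbf{B}$. Put $\hat{\mathbf{B}}:=\mathbf{A}^{*}\mathbf{B}\in\mathbb{C}^{n\times s}$ and let $\hat{\mathbf{b}}_{.j}$ denote the $j$th column of $\hat{\mathbf{B}}$, $j=1,\ldots,s$. (i) If $\operatorname{rank}\mathbf{A}=n$, then for all $i=1,\ldots,n$ and $j=1,\ldots,s$, $$x_{ij}=\frac{\det\left((\mathbf{A}^{*}\mathbf{A})_{.i}(\hat{\mathbf{b}}_{.j})\right)}{\det(\mathbf{A}^{*}\mathbf{A})}.$$ (ii) If $\operatorname{rank}\mathbf{A}=r\le m<n$, then for all $i=1,\ldots,n$ and $j=1,\ldots,s$, $$x_{ij}=\frac{\sum_{\beta\in J_{r,n}\{i\}}\left|\left((\mathbf{A}^{*}\mathbf{A})_{.i}(\hat{\mathbf{b}}_{.j})\right)_{\beta}^{\beta}\right|}{\sum_{\beta\in J_{r,n}}\left|(\mathbf{A}^{*}\mathbf{A})_{\beta}^{\beta}\right|}.$$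
   Context: $\mathbb{C}^{m\times n}$ is the set of complex $m\times n$ matrices, $\mathbf{A}^{*}$ is the Hermitian adjoint (conjugate transpose) of $\mathbf{A}$, and $\|\cdot\|$ is the Frobenius norm. Least squares solutions of $\mathbf{A}\mathbf{X}=\mathbf{B}$ are the matrices in $S_1=\{\mathbf{X}\in\mathbb{C}^{n\times s}: \|\mathbf{A}\mathbf{X}-\mathbf{B}\|=\min\}$, i.e. the minimizers of $\|\mathbf{A}\mathbf{X}-\mathbf{B}\|$ over $\mathbb{C}^{n\times s}$. The least squares solution with minimum norm, $\mathbf{X}_{LS}$, is the element of $S_1$ of smallest Frobenius norm. For a square matrix $\mathbf{M}$ and a column vector $\mathbf{b}$, $\mathbf{M}_{.i}(\mathbf{b})$ denotes the matrix obtained from $\mathbf{M}$ by replacing its $i$th column with $\mathbf{b}$. For an index set $\beta$, $|\mathbf{M}_{\beta}^{\beta}|$ denotes the principal minor of $\mathbf{M}$ determined by the rows and columns indexed by $\beta$. For $1\le k\le n$, $J_{k,n}$ is the collection of all strictly increasing sequences of $k$ integers chosen from $\{1,\ldots,n\}$ (viewed as $k$-element subsets), and $J_{k,n}\{i\}:=\{\beta\in J_{k,n}: i\in\beta\}$. The rank $r$ is assumed to be at least $1$ so that these index sets are defined. *)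

theory Defs
  imports
    "Jordan_Normal_Form.Schur_Decomposition"
    "Jordan_Normal_Form.DL_Rank"
    "Jordan_Normal_Form.DL_Submatrix"
begin

text \<open>Rows and columns are indexed from 0, as in the matrix library: the index set
  \<open>{1, \<dots>, n}\<close> of the mathematical text becomes \<open>{..<n}\<close>.\<close>

definition frobenius_norm :: "complex mat \<Rightarrow> real" where
  "frobenius_norm M = sqrt (\<Sum>i<dim_row M. \<Sum>j<dim_col M. (cmod (M $$ (i, j)))\<^sup>2)"

definition least_squares_solutions :: "complex mat \<Rightarrow> complex mat \<Rightarrow> complex mat set" where
  "least_squares_solutions A B =
    {X \<in> carrier_mat (dim_col A) (dim_col B).
      \<forall>Y \<in> carrier_mat (dim_col A) (dim_col B).
        frobenius_norm (A * X - B) \<le> frobenius_norm (A * Y - B)}"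

definition is_min_norm_least_squares_solution ::
    "complex mat \<Rightarrow> complex mat \<Rightarrow> complex mat \<Rightarrow> bool" where
  "is_min_norm_least_squares_solution A B X \<longleftrightarrow>
    X \<in> least_squares_solutions A B \<and>
    (\<forall>Y \<in> least_squares_solutions A B. frobenius_norm X \<le> frobenius_norm Y)"

definition principal_minor :: "complex mat \<Rightarrow> nat set \<Rightarrow> complex" where
  "principal_minor M \<beta> = det (submatrix M \<beta> \<beta>)"

text \<open>Strictly increasing sequences of \<open>k\<close> indices, identified with their sets of entries.\<close>

definition index_sets :: "nat \<Rightarrow> nat \<Rightarrow> nat set set" where
  "index_sets k n = {\<beta>. \<beta> \<subseteq> {..<n} \<and> card \<beta> = k}"

definition index_sets_containing :: "nat \<Rightarrow> nat \<Rightarrow> nat \<Rightarrow> nat set set" where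
  "index_sets_containing k n i = {\<beta> \<in> index_sets k n. i \<in> \<beta>}"

end

theory Submission
  imports Defs "Jordan_Normal_Form.DL_Rank_Submatrix"
begin

text \<open>Write \<open>G = A\<^sup>*A\<close> and let \<open>x\<close>, \<open>b\<close> be the \<open>j\<close>-th columns of \<open>X\<close> and \<open>A\<^sup>*B\<close>. Minimality
  of the residual gives \<open>G x = b\<close>; minimality of the norm makes \<open>x\<close> orthogonal to \<open>ker A\<close>.
  Since \<open>(G + t I) x = b + t x\<close>, Cramer's rule and linearity in the \<open>i\<close>-th column give
  \<open>x\<^sub>i det (G + t I) = det ((G + t I)\<^sub>.\<^sub>i(b)) + t det ((G + t I)\<^sub>.\<^sub>i(x))\<close>.
  Each determinant is a polynomial in \<open>t\<close> whose coefficients are sums of principal minors, and the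
  coefficient of \<open>t\<^bsup>n-r\<^esup>\<close> is the asserted identity plus a sum of minors of order \<open>r + 1\<close> of
  \<open>G\<^sub>.\<^sub>i(x)\<close>. These vanish: \<open>r + 1\<close> columns of \<open>A\<close> are dependent, and the dependency \<open>z\<close>, being in
  \<open>ker A\<close>, satisfies \<open>z\<^sup>*G = 0\<close> and \<open>z\<^sup>*x = 0\<close>. The denominator is nonzero because the principal
  minors of \<open>G\<close> are Gram determinants, all nonnegative, and positive on \<open>r\<close> independent columns.\<close>

section \<open>Principal minors and diagonal perturbations\<close>

lemma pick_bij_betw:
  assumes "finite S"
  shows "bij_betw (pick S) {..<card S} S"
proof -
  have inj: "inj_on (pick S) {..<card S}"
    by (rule linorder_inj_onI') (use pick_mono_le in fastforce)
  have "pick S ` {..<card S} \<subseteq> S" using pick_in_set_le by auto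
  moreover have "card (pick S ` {..<card S}) = card S" using inj by (simp add: card_image)
  ultimately have "pick S ` {..<card S} = S" using assms card_subset_eq by blast
  with inj show ?thesis by (simp add: bij_betw_def)
qed

lemma submatrix_carrier_subset:
  assumes "A \<in> carrier_mat m n" "I \<subseteq> {..<m}" "J \<subseteq> {..<n}"
  shows "submatrix A I J \<in> carrier_mat (card I) (card J)"
proof -
  have "{i. i < m \<and> i \<in> I} = I" "{i. i < n \<and> i \<in> J} = J" using assms by auto
  then show ?thesis using assms(1) by (intro carrier_matI) (simp_all add: dim_submatrix)
qed

lemma submatrix_index_subset:
  assumes "A \<in> carrier_mat m n" "I \<subseteq> {..<m}" "J \<subseteq> {..<n}" "a < card I" "b < card J"
  shows "submatrix A I J $$ (a, b) = A $$ (pick I a, pick J b)"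
proof -
  have "{i. i < m \<and> i \<in> I} = I" "{i. i < n \<and> i \<in> J} = J" using assms by auto
  then show ?thesis using assms(1,4,5) by (intro submatrix_index) simp_all
qed

text \<open>Listing \<beta> first, in increasing order, moves a principal submatrix to the upper
  left corner. The order of the remaining indices is arbitrary, so any bijection between sets of
  equal cardinality completes the permutation.\<close>

lemma permutes_extending_pick:
  assumes \<beta>: "\<beta> \<subseteq> {..<n}"
  obtains p where "p permutes {0..<n}" "\<And>a. a < card \<beta> \<Longrightarrow> p a = pick \<beta> a"
    "\<And>a. card \<beta> \<le> a \<Longrightarrow> a < n \<Longrightarrow> p a \<notin> \<beta>"
proof -
  have fin: "finite \<beta>" using \<beta> finite_subset by blast
  have k: "card \<beta> \<le> n" using card_mono[OF _ \<beta>] by simp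
  have "card {card \<beta>..<n} = card ({..<n} - \<beta>)" using \<beta> fin by (simp add: card_Diff_subset)
  then obtain q where q: "bij_betw q {card \<beta>..<n} ({..<n} - \<beta>)"
    using finite_same_card_bij[of "{card \<beta>..<n}" "{..<n} - \<beta>"] by auto
  \<comment> \<open>The last branch fixes every index from \<open>n\<close> on, as
    \<open>permutes\<close> requires outside its set.\<close>
  define p where "p a = (if a < card \<beta> then pick \<beta> a else if a < n then q a else a)" for a
  have "bij_betw p {..<card \<beta>} \<beta>"
    using bij_betw_cong[of "{..<card \<beta>}" p "pick \<beta>" \<beta>] pick_bij_betw[OF fin]
    by (simp add: p_def)
  moreover have "bij_betw p {card \<beta>..<n} ({..<n} - \<beta>)"
    using bij_betw_cong[of "{card \<beta>..<n}" p q "{..<n} - \<beta>"] q by (simp add: p_def)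
  ultimately have "bij_betw p ({..<card \<beta>} \<union> {card \<beta>..<n}) (\<beta> \<union> ({..<n} - \<beta>))"
    by (rule bij_betw_combine) auto
  moreover have "{..<card \<beta>} \<union> {card \<beta>..<n} = {0..<n}" "\<beta> \<union> ({..<n} - \<beta>) = {0..<n}"
    using k \<beta> by auto
  ultimately have "p permutes {0..<n}"
    using k by (intro bij_imp_permutes) (auto simp: p_def)
  moreover have "p a \<notin> \<beta>" if "card \<beta> \<le> a" "a < n" for a
    using bij_betwE[OF q] that by (auto simp: p_def)
  ultimately show ?thesis using that by (auto simp: p_def)
qed

text \<open>Rows and columns each contribute the factor \<open>signof p\<close>, whose square is 1.
  The columns are permuted as rows of the transpose.\<close>

lemma det_permute_rows_cols:
  assumes A: "A \<in> carrier_mat n n" and p: "p permutes {0..<n}"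
  shows "det (mat n n (\<lambda>(i, j). A $$ (p i, p j))) = det A"
proof -
  let ?B = "mat n n (\<lambda>(i, j). A $$ (p i, j))"
  have lt: "p i < n" if "i < n" for i using permutes_in_image[OF p, of i] that by simp
  have "mat n n (\<lambda>(i, j). A $$ (p i, p j))
      = transpose_mat (mat n n (\<lambda>(i, j). transpose_mat ?B $$ (p i, j)))"
    by (rule eq_matI) (auto simp: lt)
  then have "det (mat n n (\<lambda>(i, j). A $$ (p i, p j)))
      = det (mat n n (\<lambda>(i, j). transpose_mat ?B $$ (p i, j)))"
    by (simp add: det_transpose[of _ n])
  also have "\<dots> = signof p * (signof p * det A)"
    by (subst det_permute_rows[OF _ p, of "transpose_mat ?B"])
       (auto simp: det_transpose[of _ n] det_permute_rows[OF A p])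
  also have "\<dots> = det A" by (simp add: sign_def)
  finally show ?thesis .
qed

text \<open>Putting unit vectors in the columns outside \<beta> makes every principal minor an
  n-by-n determinant. The Leibniz expansions for different \<beta> then run over the same
  permutations and can be compared term by term.\<close>

lemma principal_minor_eq_det:
  assumes R: "R \<in> carrier_mat n n" and \<beta>: "\<beta> \<subseteq> {..<n}"
  shows "principal_minor R \<beta>
    = det (mat n n (\<lambda>(i, j). if j \<in> \<beta> then R $$ (i, j) else if i = j then 1 else 0))"
    (is "_ = det ?E")
proof -
  let ?k = "card \<beta>"
  have k: "?k \<le> n" using card_mono[OF _ \<beta>] by simp
  obtain p where p: "p permutes {0..<n}" "\<And>a. a < ?k \<Longrightarrow> p a = pick \<beta> a"
    "\<And>a. ?k \<le> a \<Longrightarrow> a < n \<Longrightarrow> p a \<notin> \<beta>"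
    using permutes_extending_pick[OF \<beta>] by metis
  have lt: "p i < n" if "i < n" for i using permutes_in_image[OF p(1), of i] that by simp
  have in\<beta>: "p a \<in> \<beta>" if "a < ?k" for a using p(2) that pick_in_set_le by simp
  have inj: "p a = p b \<longleftrightarrow> a = b" for a b using permutes_inj[OF p(1)] by (auto dest: injD)
  \<comment> \<open>Moving the indices in \<open>\<beta>\<close> to the front makes the matrix block lower triangular.\<close>
  define L where "L = mat (n - ?k) ?k (\<lambda>(i, j). ?E $$ (p (i + ?k), p j))"
  have "mat n n (\<lambda>(i, j). ?E $$ (p i, p j))
      = four_block_mat (submatrix R \<beta> \<beta>) (0\<^sub>m ?k (n - ?k)) L (1\<^sub>m (n - ?k))" (is "_ = ?F")
  proof (rule eq_matI)
    have S: "dim_row (submatrix R \<beta> \<beta>) = ?k" "dim_col (submatrix R \<beta> \<beta>) = ?k"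
      using submatrix_carrier_subset[OF R \<beta> \<beta>] by auto
    show "dim_row (mat n n (\<lambda>(i, j). ?E $$ (p i, p j))) = dim_row ?F"
      "dim_col (mat n n (\<lambda>(i, j). ?E $$ (p i, p j))) = dim_col ?F"
      using k by (simp_all add: S)
    fix i j assume "i < dim_row ?F" "j < dim_col ?F"
    then have ij: "i < n" "j < n" using k by (simp_all add: S)
    consider "i < ?k" "j < ?k" | "i < ?k" "\<not> j < ?k" | "\<not> i < ?k" "j < ?k"
      | "\<not> i < ?k" "\<not> j < ?k" by blast
    then show "mat n n (\<lambda>(i, j). ?E $$ (p i, p j)) $$ (i, j) = ?F $$ (i, j)"
    proof cases
      case 1
      then show ?thesis
        using ij in\<beta>[of j] by (simp add: S lt submatrix_index_subset[OF R \<beta> \<beta>] p(2)[symmetric])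
    next
      case 2
      then show ?thesis using ij p(3)[of j] by (auto simp add: S lt inj)
    next
      case 3
      then show ?thesis using ij by (simp add: S L_def)
    next
      case 4
      then show ?thesis using ij p(3)[of j] by (auto simp add: S lt inj)
    qed
  qed
  then have "det ?E = det ?F" using det_permute_rows_cols[OF _ p(1), of ?E] by simp
  also have "\<dots> = det (submatrix R \<beta> \<beta>)"
    by (subst det_four_block_mat_upper_right_zero[OF submatrix_carrier_subset[OF R \<beta> \<beta>]])
       (auto simp: L_def)
  finally show ?thesis by (simp add: principal_minor_def)
qed

lemma principal_minor_lessThan:
  assumes "M \<in> carrier_mat n n"
  shows "principal_minor M {..<n} = det M"
proof -
  have "mat n n (\<lambda>(i, j). if j \<in> {..<n} then M $$ (i, j) else if i = j then 1 else 0) = M"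
    using assms by (intro eq_matI) auto
  then show ?thesis using principal_minor_eq_det[OF assms, of "{..<n}"] by simp
qed

text \<open>In each Leibniz product every column offers a choice between its entry of
  \<open>R\<close> and its diagonal term. Collecting by the set \<beta> of columns that chose
  \<open>R\<close> leaves the expansion of the full-size form of the minor. The diagonal may vary
  with the column, so that a replaced column can be given the term 0.\<close>

lemma det_add_diagonal:
  assumes R: "R \<in> carrier_mat n n"
  shows "det (mat n n (\<lambda>(i, j). R $$ (i, j) + (if i = j then s j else 0)))
    = (\<Sum>\<beta>\<in>Pow {..<n}. (\<Prod>j\<in>{..<n} - \<beta>. s j) * principal_minor R \<beta>)"
proof -
  let ?P = "{p. p permutes {0..<n}}"
  have lt: "p i < n" if "i < n" "p permutes {0..<n}" for i p
    using permutes_in_image[OF that(2), of i] that by simp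
  have "det (mat n n (\<lambda>(i, j). R $$ (i, j) + (if i = j then s j else 0)))
    = (\<Sum>p\<in>?P. signof p * (\<Prod>j<n. R $$ (p j, j) + (if p j = j then s j else 0)))"
    by (subst det_col) (auto intro!: sum.cong prod.cong simp: lt)
  also have "\<dots> = (\<Sum>p\<in>?P. \<Sum>\<beta>\<in>Pow {..<n}. signof p *
      ((\<Prod>j\<in>\<beta>. R $$ (p j, j)) * (\<Prod>j\<in>{..<n} - \<beta>. if p j = j then s j else 0)))"
    by (simp add: prod_add sum_distrib_left)
  also have "\<dots> = (\<Sum>\<beta>\<in>Pow {..<n}. \<Sum>p\<in>?P. signof p *
      ((\<Prod>j\<in>\<beta>. R $$ (p j, j)) * (\<Prod>j\<in>{..<n} - \<beta>. if p j = j then s j else 0)))"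
    by (rule sum.swap)
  also have "\<dots> = (\<Sum>\<beta>\<in>Pow {..<n}. (\<Prod>j\<in>{..<n} - \<beta>. s j) * principal_minor R \<beta>)"
  proof (rule sum.cong[OF refl])
    fix \<beta> assume "\<beta> \<in> Pow {..<n}"
    then have \<beta>: "\<beta> \<subseteq> {..<n}" by simp
    have split: "(\<Prod>j<n. f j) = (\<Prod>j\<in>\<beta>. f j) * (\<Prod>j\<in>{..<n} - \<beta>. f j)" for f :: "nat \<Rightarrow> complex"
      using prod.subset_diff[OF \<beta>, of f] by (simp add: mult.commute)
    have "(\<Prod>j\<in>{..<n} - \<beta>. s j) * principal_minor R \<beta>
      = (\<Sum>p\<in>?P. (\<Prod>j\<in>{..<n} - \<beta>. s j) * (signof p *
          (\<Prod>j<n. if j \<in> \<beta> then R $$ (p j, j) else if p j = j then 1 else 0)))"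
      unfolding principal_minor_eq_det[OF R \<beta>]
      by (subst det_col[of _ n]) (auto simp: sum_distrib_left lt intro!: sum.cong prod.cong)
    also have "\<dots> = (\<Sum>p\<in>?P. signof p *
      ((\<Prod>j\<in>\<beta>. R $$ (p j, j)) * (\<Prod>j\<in>{..<n} - \<beta>. if p j = j then s j else 0)))"
    proof (rule sum.cong[OF refl])
      fix p
      \<comment> \<open>If \<open>p\<close> moves some index outside \<beta>, both sides vanish;
        otherwise the indicators are all 1.\<close>
      have "(\<Prod>j\<in>{..<n} - \<beta>. if p j = j then s j else 0)
        = (\<Prod>j\<in>{..<n} - \<beta>. s j) * (\<Prod>j\<in>{..<n} - \<beta>. if p j = j then 1 else 0)"
        unfolding prod.distrib[symmetric] by (rule prod.cong) auto
      then show "(\<Prod>j\<in>{..<n} - \<beta>. s j) * (signof p *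
          (\<Prod>j<n. if j \<in> \<beta> then R $$ (p j, j) else if p j = j then 1 else 0))
        = signof p * ((\<Prod>j\<in>\<beta>. R $$ (p j, j)) * (\<Prod>j\<in>{..<n} - \<beta>. if p j = j then s j else 0))"
        unfolding split by simp
    qed
    finally show "(\<Sum>p\<in>?P. signof p *
      ((\<Prod>j\<in>\<beta>. R $$ (p j, j)) * (\<Prod>j\<in>{..<n} - \<beta>. if p j = j then s j else 0)))
      = (\<Prod>j\<in>{..<n} - \<beta>. s j) * principal_minor R \<beta>" by simp
  qed
  finally show ?thesis .
qed

section \<open>Column replacement and Cramer's rule for a shifted matrix\<close>

lemma replace_col_carrier:
  "A \<in> carrier_mat m n \<Longrightarrow> replace_col A v i \<in> carrier_mat m n"
  by (simp add: replace_col_def)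

lemma col_replace_col:
  assumes "A \<in> carrier_mat m n" "v \<in> carrier_vec m" "j < n"
  shows "col (replace_col A v i) j = (if j = i then v else col A j)"
  using assms by (intro eq_vecI) (auto simp: replace_col_def)

text \<open>In the Laplace expansion along column \<open>j\<close> the cofactors do not see the
  entries of that column, so the determinant is a linear functional of the inserted vector.\<close>

lemma det_replace_col_linear:
  fixes A :: "'a :: comm_ring_1 mat"
  assumes A: "A \<in> carrier_mat n n" and u: "u \<in> carrier_vec n" and v: "v \<in> carrier_vec n"
    and j: "j < n"
  shows "det (replace_col A (u + c \<cdot>\<^sub>v v) j) = det (replace_col A u j) + c * det (replace_col A v j)"
proof -
  have *: "det (replace_col A w j) = (\<Sum>i<n. w $ i * cofactor A i j)" for w
  proof -
    have "mat_delete (replace_col A w j) i j = mat_delete A i j" for i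
      using A j by (intro eq_matI) (auto simp: mat_delete_def replace_col_def)
    then show ?thesis
      using A j by (subst laplace_expansion_column[OF replace_col_carrier[OF A] j])
        (simp add: replace_col_def cofactor_def)
  qed
  show ?thesis unfolding * using u v
    by (simp add: algebra_simps sum.distrib sum_distrib_left)
qed

text \<open>This is the classical description of the coefficients of the characteristic polynomial,
  with the sign of the variable changed.\<close>

lemma det_add_scalar:
  assumes R: "R \<in> carrier_mat n n"
  shows "det (R + t \<cdot>\<^sub>m 1\<^sub>m n) = (\<Sum>\<beta>\<in>Pow {..<n}. t ^ (n - card \<beta>) * principal_minor R \<beta>)"
proof -
  have "R + t \<cdot>\<^sub>m 1\<^sub>m n = mat n n (\<lambda>(i, j). R $$ (i, j) + (if i = j then t else 0))"
    using R by (intro eq_matI) auto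
  then have "det (R + t \<cdot>\<^sub>m 1\<^sub>m n)
      = (\<Sum>\<beta>\<in>Pow {..<n}. (\<Prod>j\<in>{..<n} - \<beta>. t) * principal_minor R \<beta>)"
    using det_add_diagonal[OF R, where s = "\<lambda>_. t"] by simp
  also have "\<dots> = (\<Sum>\<beta>\<in>Pow {..<n}. t ^ (n - card \<beta>) * principal_minor R \<beta>)"
    by (intro sum.cong) (auto simp: card_Diff_subset finite_subset[OF _ finite_lessThan])
  finally show ?thesis .
qed

lemma det_replace_col_add_scalar:
  assumes R: "R \<in> carrier_mat n n" and i: "i < n"
  shows "det (replace_col (R + t \<cdot>\<^sub>m 1\<^sub>m n) c i)
    = (\<Sum>\<beta>\<in>{\<beta>\<in>Pow {..<n}. i \<in> \<beta>}. t ^ (n - card \<beta>) * principal_minor (replace_col R c i) \<beta>)"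
proof -
  \<comment> \<open>Replacing column \<open>i\<close> also removes its diagonal term \<open>t\<close>, which kills every \<open>\<beta>\<close> without \<open>i\<close>.\<close>
  let ?s = "\<lambda>j. if j = i then 0 else t"
  have "replace_col (R + t \<cdot>\<^sub>m 1\<^sub>m n) c i
      = mat n n (\<lambda>(k, j). replace_col R c i $$ (k, j) + (if k = j then ?s j else 0))"
    using R i by (intro eq_matI) (auto simp: replace_col_def)
  then have "det (replace_col (R + t \<cdot>\<^sub>m 1\<^sub>m n) c i)
      = (\<Sum>\<beta>\<in>Pow {..<n}. (\<Prod>j\<in>{..<n} - \<beta>. ?s j) * principal_minor (replace_col R c i) \<beta>)"
    using det_add_diagonal[OF replace_col_carrier[OF R], where s = ?s] by simp
  also have "\<dots> = (\<Sum>\<beta>\<in>{\<beta>\<in>Pow {..<n}. i \<in> \<beta>}.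
      (\<Prod>j\<in>{..<n} - \<beta>. ?s j) * principal_minor (replace_col R c i) \<beta>)"
    using i by (intro sum.mono_neutral_right) auto
  also have "\<dots> = (\<Sum>\<beta>\<in>{\<beta>\<in>Pow {..<n}. i \<in> \<beta>}.
      t ^ (n - card \<beta>) * principal_minor (replace_col R c i) \<beta>)"
  proof (rule sum.cong[OF refl])
    fix \<beta> assume \<beta>: "\<beta> \<in> {\<beta>\<in>Pow {..<n}. i \<in> \<beta>}"
    have "(\<Prod>j\<in>{..<n} - \<beta>. ?s j) = (\<Prod>j\<in>{..<n} - \<beta>. t)"
      using \<beta> by (intro prod.cong) auto
    also have "\<dots> = t ^ (n - card \<beta>)"
      using \<beta> by (auto simp: card_Diff_subset finite_subset[OF _ finite_lessThan])
    finally show "(\<Prod>j\<in>{..<n} - \<beta>. ?s j) * principal_minor (replace_col R c i) \<beta>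
      = t ^ (n - card \<beta>) * principal_minor (replace_col R c i) \<beta>" by simp
  qed
  finally show ?thesis .
qed

text \<open>Cramer's rule for \<open>G\<close> alone sees only minors of order \<open>n\<close>.
  Applied to \<open>G + t I\<close> it is an identity of polynomials in \<open>t\<close>, and the
  coefficient of \<open>t ^ (n - r)\<close> isolates the minors of order \<open>r\<close>.\<close>

lemma sum_principal_minors_cramer:
  assumes G: "G \<in> carrier_mat n n" and x: "x \<in> carrier_vec n" and i: "i < n" and r: "r \<le> n"
  shows "x $ i * (\<Sum>\<beta>\<in>index_sets r n. principal_minor G \<beta>)
    = (\<Sum>\<beta>\<in>index_sets_containing (Suc r) n i. principal_minor (replace_col G x i) \<beta>)
    + (\<Sum>\<beta>\<in>index_sets_containing r n i. principal_minor (replace_col G (G *\<^sub>v x) i) \<beta>)"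
proof -
  let ?J = "{\<beta>\<in>Pow {..<n}. i \<in> \<beta>}"
  define P where "P = (\<Sum>\<beta>\<in>Pow {..<n}. monom (x $ i * principal_minor G \<beta>) (n - card \<beta>))"
  \<comment> \<open>\<open>Q\<close> represents \<open>t\<close> times a determinant. The additional
    factor raises each exponent by one, so minors of order \<open>Suc r\<close> meet those of order
    \<open>r\<close> in \<open>P\<close> and \<open>S\<close>.\<close>
  define Q where "Q = (\<Sum>\<beta>\<in>?J. monom (principal_minor (replace_col G x i) \<beta>) (Suc n - card \<beta>))"
  define S where "S = (\<Sum>\<beta>\<in>?J. monom (principal_minor (replace_col G (G *\<^sub>v x) i) \<beta>) (n - card \<beta>))"
  have le: "card \<beta> \<le> n" if "\<beta> \<subseteq> {..<n}" for \<beta> using card_mono[OF _ that] by simp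
  have "poly P t = poly (Q + S) t" for t
  proof -
    let ?G = "G + t \<cdot>\<^sub>m 1\<^sub>m n"
    have "t \<cdot>\<^sub>m 1\<^sub>m n *\<^sub>v x = t \<cdot>\<^sub>v x"
      using x by (intro eq_vecI) (auto simp: row_smult)
    then have "?G *\<^sub>v x = G *\<^sub>v x + t \<cdot>\<^sub>v x"
      using G x by (simp add: add_mult_distrib_mat_vec[of _ n n])
    then have "x $ i * det ?G = det (replace_col ?G (G *\<^sub>v x) i) + t * det (replace_col ?G x i)"
      using cramer_lemma_mat[of ?G n x i] G x i
        det_replace_col_linear[of ?G n "G *\<^sub>v x" x i t] by simp
    moreover have "poly P t = x $ i * det ?G"
      unfolding det_add_scalar[OF G] P_def poly_sum poly_monom sum_distrib_left
      by (intro sum.cong) (simp_all add: mult_ac)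
    moreover have "poly Q t = t * det (replace_col ?G x i)"
      unfolding det_replace_col_add_scalar[OF G i] Q_def poly_sum poly_monom sum_distrib_left
      using le by (intro sum.cong) (auto simp: Suc_diff_le)
    moreover have "poly S t = det (replace_col ?G (G *\<^sub>v x) i)"
      unfolding det_replace_col_add_scalar[OF G i] S_def poly_sum poly_monom
      by (intro sum.cong) simp_all
    ultimately show ?thesis by simp
  qed
  \<comment> \<open>Polynomials agreeing at every complex number have equal coefficients.\<close>
  then have "P = Q + S" by (simp add: fun_eq_iff flip: poly_eq_poly_eq_iff)
  \<comment> \<open>The bounds \<open>card \<beta> \<le> n\<close> and \<open>r \<le> n\<close> keep
    the truncated subtraction on naturals exact.\<close>
  moreover have eq: "n - card \<beta> = n - r \<longleftrightarrow> card \<beta> = r"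
    "Suc n - card \<beta> = n - r \<longleftrightarrow> card \<beta> = Suc r" if "\<beta> \<subseteq> {..<n}" for \<beta>
    using le[OF that] r by auto
  ultimately have "coeff P (n - r) = coeff Q (n - r) + coeff S (n - r)" by simp
  moreover have "coeff P (n - r) = x $ i * (\<Sum>\<beta>\<in>index_sets r n. principal_minor G \<beta>)"
    unfolding P_def coeff_sum coeff_monom sum_distrib_left
    by (intro sum.mono_neutral_cong_right) (auto simp: eq index_sets_def)
  moreover have "coeff Q (n - r)
      = (\<Sum>\<beta>\<in>index_sets_containing (Suc r) n i. principal_minor (replace_col G x i) \<beta>)"
    unfolding Q_def coeff_sum coeff_monom
    by (intro sum.mono_neutral_cong_right)
      (auto simp: eq index_sets_def index_sets_containing_def)
  moreover have "coeff S (n - r)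
      = (\<Sum>\<beta>\<in>index_sets_containing r n i. principal_minor (replace_col G (G *\<^sub>v x) i) \<beta>)"
    unfolding S_def coeff_sum coeff_monom
    by (intro sum.mono_neutral_cong_right)
      (auto simp: eq index_sets_def index_sets_containing_def)
  ultimately show ?thesis by simp
qed

section \<open>Gram matrices\<close>

lemma submatrix_UNIV_cols:
  assumes "A \<in> carrier_mat m n" "J \<subseteq> {..<n}"
  shows "submatrix A UNIV J \<in> carrier_mat m (card J)"
    and "a < m \<Longrightarrow> b < card J \<Longrightarrow> submatrix A UNIV J $$ (a, b) = A $$ (a, pick J b)"
    and "b < card J \<Longrightarrow> col (submatrix A UNIV J) b = col A (pick J b)"
proof -
  have *: "{i. i < n \<and> i \<in> J} = J" "{i. i < m \<and> i \<in> UNIV} = {..<m}" using assms by auto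
  show car: "submatrix A UNIV J \<in> carrier_mat m (card J)"
    using assms(1) * by (intro carrier_matI) (simp_all add: dim_submatrix)
  show idx: "submatrix A UNIV J $$ (a, b) = A $$ (a, pick J b)" if "a < m" "b < card J" for a b
    using submatrix_index[of a A UNIV b J] assms(1) * that by (simp add: pick_UNIV)
  show "col (submatrix A UNIV J) b = col A (pick J b)" if "b < card J"
  proof -
    have "pick J b < n" using pick_in_set_le[OF that] assms(2) by auto
    then show ?thesis using that car assms(1) by (intro eq_vecI) (simp_all add: idx)
  qed
qed

lemma mat_adjoint_carrier: "A \<in> carrier_mat m n \<Longrightarrow> mat_adjoint A \<in> carrier_mat n m"
  by (auto simp: mat_adjoint_def)

lemma mat_adjoint_index:
  assumes "A \<in> carrier_mat m n" "i < n" "j < m"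
  shows "mat_adjoint A $$ (i, j) = conjugate (A $$ (j, i))"
  using assms by (simp add: mat_adjoint_def mat_of_rows_def)

lemma adjoint_mult_index:
  fixes A B :: "complex mat"
  assumes "A \<in> carrier_mat m n" "B \<in> carrier_mat m s" "i < n" "j < s"
  shows "(mat_adjoint A * B) $$ (i, j) = (\<Sum>l<m. cnj (A $$ (l, i)) * B $$ (l, j))"
  using assms mat_adjoint_carrier[OF assms(1)]
  by (simp add: scalar_prod_def mat_adjoint_index atLeast0LessThan)

lemma adjoint_mult_vec_cscalar:
  fixes A :: "complex mat"
  assumes A: "A \<in> carrier_mat m n" and w: "w \<in> carrier_vec m" and v: "v \<in> carrier_vec n"
  shows "(mat_adjoint A *\<^sub>v w) \<bullet>c v = w \<bullet>c (A *\<^sub>v v)"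
proof -
  have "(mat_adjoint A *\<^sub>v w) \<bullet>c v = (\<Sum>i<n. \<Sum>l<m. cnj (A $$ (l, i)) * w $ l * cnj (v $ i))"
    using A w v mat_adjoint_carrier[OF A]
    by (simp add: scalar_prod_def mat_adjoint_index atLeast0LessThan sum_distrib_right)
  also have "\<dots> = (\<Sum>l<m. \<Sum>i<n. cnj (A $$ (l, i)) * w $ l * cnj (v $ i))"
    by (rule sum.swap)
  also have "\<dots> = w \<bullet>c (A *\<^sub>v v)"
    using A w v by (simp add: scalar_prod_def atLeast0LessThan sum_distrib_left mult_ac)
  finally show ?thesis .
qed

lemma gram_cscalar:
  fixes A :: "complex mat"
  assumes A: "A \<in> carrier_mat m n" and v: "v \<in> carrier_vec n"
  shows "(mat_adjoint A * A *\<^sub>v v) \<bullet>c v = (A *\<^sub>v v) \<bullet>c (A *\<^sub>v v)"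
  using adjoint_mult_vec_cscalar[OF A _ v, of "A *\<^sub>v v"] A v mat_adjoint_carrier[OF A]
  by (simp add: assoc_mult_mat_vec[of _ n m _ n])

text \<open>An eigenvalue equals its Rayleigh quotient, the squared length of
  \<open>A *\<^sub>v v\<close> over that of \<open>v\<close>. In the order on complex numbers,
  \<open>0 \<le> e\<close> also says that \<open>e\<close> is real.\<close>

lemma gram_eigenvalue_nonneg:
  fixes A :: "complex mat"
  assumes A: "A \<in> carrier_mat m n" and e: "eigenvalue (mat_adjoint A * A) e"
  shows "0 \<le> e"
proof -
  obtain v where v: "v \<in> carrier_vec n" "v \<noteq> 0\<^sub>v n" "mat_adjoint A * A *\<^sub>v v = e \<cdot>\<^sub>v v"
    using e mat_adjoint_carrier[OF A] unfolding eigenvalue_def eigenvector_def by auto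
  have eq: "e * (v \<bullet>c v) = (A *\<^sub>v v) \<bullet>c (A *\<^sub>v v)"
    using gram_cscalar[OF A v(1)] v by simp
  have pos: "0 < v \<bullet>c v" using v by simp
  have "e = ((A *\<^sub>v v) \<bullet>c (A *\<^sub>v v)) / (v \<bullet>c v)" using eq pos by (simp add: field_simps)
  moreover have "0 \<le> (A *\<^sub>v v) \<bullet>c (A *\<^sub>v v)" by (rule conjugate_square_ge_0_vec)
  ultimately show ?thesis using pos
    by (auto simp: less_eq_complex_def less_complex_def Re_divide Im_divide)
qed

text \<open>The Schur decomposition is triangular with the eigenvalues on its diagonal, so the
  determinant is a product of nonnegative numbers.\<close>

lemma det_gram_nonneg:
  fixes A :: "complex mat"
  assumes A: "A \<in> carrier_mat m n"
  shows "0 \<le> det (mat_adjoint A * A)"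
proof -
  let ?M = "mat_adjoint A * A"
  have M: "?M \<in> carrier_mat n n" using A mat_adjoint_carrier[OF A] by simp
  obtain es where es: "char_poly ?M = (\<Prod>e\<leftarrow>es. [:- e, 1:])"
    using char_poly_factorized[OF M] by blast
  obtain T P Q where "schur_decomposition ?M es = (T, P, Q)"
    by (cases "schur_decomposition ?M es")
  then have T: "similar_mat_wit ?M T P Q" "upper_triangular T" "diag_mat T = es"
    using schur_decomposition[OF M es] by auto
  have "0 \<le> prod_list es"
  proof -
    have "0 \<le> e" if "e \<in> set es" for e
    proof -
      have "poly (char_poly ?M) e = 0"
        using that unfolding es poly_prod_list by (auto simp: prod_list_zero_iff)
      then show ?thesis
        using gram_eigenvalue_nonneg[OF A] eigenvalue_root_char_poly[OF M] by blast
    qed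
    then show ?thesis by (induction es) (auto simp: less_eq_complex_def)
  qed
  moreover have "det ?M = prod_list es"
    using T det_similar[of ?M T] det_upper_triangular[OF T(2), of n] similar_mat_witD2[OF M T(1)]
    by (auto simp: similar_mat_def)
  ultimately show ?thesis by simp
qed

text \<open>A kernel vector of the Gram matrix is a kernel vector of \<open>A\<close>, because
  \<open>gram_cscalar\<close> turns the vanishing product into the squared length of
  \<open>A *\<^sub>v v\<close>.\<close>

lemma det_gram_eq_0D:
  fixes A :: "complex mat"
  assumes A: "A \<in> carrier_mat m n" and "det (mat_adjoint A * A) = 0"
  obtains v where "v \<in> carrier_vec n" "v \<noteq> 0\<^sub>v n" "A *\<^sub>v v = 0\<^sub>v m"
proof -
  have "mat_adjoint A * A \<in> carrier_mat n n" using A mat_adjoint_carrier[OF A] by simp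
  then obtain v where v: "v \<in> carrier_vec n" "v \<noteq> 0\<^sub>v n" "mat_adjoint A * A *\<^sub>v v = 0\<^sub>v n"
    using assms(2) det_0_iff_vec_prod_zero by blast
  then have "(A *\<^sub>v v) \<bullet>c (A *\<^sub>v v) = 0" using gram_cscalar[OF A v(1)] by simp
  then have "A *\<^sub>v v = 0\<^sub>v m" using A v(1) by (subst (asm) conjugate_square_eq_0_vec[of _ m]) auto
  then show ?thesis using that v by blast
qed

section \<open>Rank in terms of independent and dependent columns\<close>

lemma exists_rank_independent_cols:
  fixes A :: "'a :: field mat"
  assumes A: "A \<in> carrier_mat m n"
  obtains \<beta> where "\<beta> \<subseteq> {..<n}" "card \<beta> = vec_space.rank m A"
    "\<And>v. v \<in> carrier_vec (card \<beta>) \<Longrightarrow> submatrix A UNIV \<beta> *\<^sub>v v = 0\<^sub>v m \<Longrightarrow> v = 0\<^sub>v (card \<beta>)"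
proof -
  interpret vec_space "TYPE('a)" m .
  have "lin_indpt {}" by (simp add: lin_dep_def)
  let ?I = "\<lambda>T. T \<subseteq> set (cols A) \<and> lin_indpt T"
  have "\<exists>S. finite S \<and> maximal S ?I \<and> {} \<subseteq> S"
  proof (rule maximal_exists_superset)
    show "finite (set (cols A))" by simp
    show "T \<subseteq> set (cols A)" if "?I T" for T using that by simp
    show "?I {}" using \<open>lin_indpt {}\<close> by simp
  qed
  then obtain S where "finite S \<and> maximal S ?I \<and> {} \<subseteq> S" ..
  then have S: "maximal S ?I" by (elim conjE)
  then have sub: "S \<subseteq> col A ` {..<n}" and ind: "lin_indpt S"
    using A unfolding maximal_def cols_def by (simp_all add: atLeast0LessThan)
  \<comment> \<open>\<open>S\<close> is a set of vectors, but a set of indices is wanted. Choosing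
    one index per vector makes \<open>col A\<close> injective on \<beta>, so repeated columns of
    \<open>A\<close> do not disturb the count.\<close>
  obtain \<beta> where \<beta>: "\<beta> \<subseteq> {..<n}" "inj_on (col A) \<beta>" "S = col A ` \<beta>"
    using sub by (meson subset_image_inj)
  have card: "card \<beta> = rank A"
    using rank_card_indpt[OF A S] \<beta> by (simp add: card_image)
  let ?C = "submatrix A UNIV \<beta>"
  note C = submatrix_UNIV_cols[OF A \<beta>(1)]
  have pick: "bij_betw (pick \<beta>) {..<card \<beta>} \<beta>"
    using pick_bij_betw finite_subset[OF \<beta>(1)] by blast
  have cols: "cols ?C = map (\<lambda>a. col A (pick \<beta> a)) [0..<card \<beta>]"
    using C by (auto simp: cols_def)
  have "set (cols ?C) = S"
    using image_image[of "col A" "pick \<beta>" "{..<card \<beta>}"] bij_betw_imp_surj_on[OF pick] \<beta>(3)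
    by (simp add: cols atLeast0LessThan)
  moreover have "distinct (cols ?C)"
    using comp_inj_on[OF bij_betw_imp_inj_on[OF pick], of "col A"] \<beta>(2) bij_betw_imp_surj_on[OF pick]
    by (simp add: cols distinct_map atLeast0LessThan comp_def)
  ultimately have "v = 0\<^sub>v (card \<beta>)" if "v \<in> carrier_vec (card \<beta>)" "?C *\<^sub>v v = 0\<^sub>v m" for v
    using lin_depI[OF C(1) that(1) _ that(2)] ind by metis
  then show ?thesis using that \<beta>(1) card by blast
qed

text \<open>Linear dependence concerns sets of vectors, hence the case split. Distinct columns form
  a set with more elements than the rank; two equal columns give a difference of unit vectors as the
  dependency.\<close>

lemma card_gt_rank_dependent_cols:
  fixes A :: "'a :: field mat"
  assumes A: "A \<in> carrier_mat m n" and \<beta>: "\<beta> \<subseteq> {..<n}" and gt: "vec_space.rank m A < card \<beta>"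
  obtains v where "v \<in> carrier_vec (card \<beta>)" "v \<noteq> 0\<^sub>v (card \<beta>)"
    "submatrix A UNIV \<beta> *\<^sub>v v = 0\<^sub>v m"
proof (cases "distinct (cols (submatrix A UNIV \<beta>))")
  case True
  interpret vec_space "TYPE('a)" m .
  let ?C = "submatrix A UNIV \<beta>"
  note C = submatrix_UNIV_cols[OF A \<beta>]
  have "card (set (cols ?C)) = card \<beta>" using True C(1) by (simp add: distinct_card)
  then have "lin_dep (set (cols ?C))"
    using rank_ge_card_indpt[OF A cols_submatrix_subset, of \<beta>] gt by auto
  then show ?thesis using lin_depE[OF C(1) _ True] that by blast
next
  case False
  let ?C = "submatrix A UNIV \<beta>"
  note C = submatrix_UNIV_cols(1)[OF A \<beta>]
  obtain a b where ab: "a < card \<beta>" "b < card \<beta>" "a \<noteq> b" "col ?C a = col ?C b"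
    using False C by (auto simp: distinct_conv_nth)
  let ?v = "unit_vec (card \<beta>) a - unit_vec (card \<beta>) b :: 'a vec"
  have "?C *\<^sub>v unit_vec (card \<beta>) c = col ?C c" if "c < card \<beta>" for c
    using C that by (intro eq_vecI) auto
  then have "?C *\<^sub>v ?v = 0\<^sub>v m"
    using C ab by (simp add: mult_minus_distrib_mat_vec[OF C])
  moreover have "?v $ a \<noteq> 0\<^sub>v (card \<beta>) $ a" using ab by simp
  then have "?v \<noteq> 0\<^sub>v (card \<beta>)" by metis
  ultimately show ?thesis using that[of ?v] by simp
qed

section \<open>Principal minors of the Gram matrix\<close>

lemma principal_minor_gram:
  fixes A :: "complex mat"
  assumes A: "A \<in> carrier_mat m n" and \<beta>: "\<beta> \<subseteq> {..<n}"
  shows "principal_minor (mat_adjoint A * A) \<beta>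
    = det (mat_adjoint (submatrix A UNIV \<beta>) * submatrix A UNIV \<beta>)"
proof -
  let ?C = "submatrix A UNIV \<beta>"
  note C = submatrix_UNIV_cols[OF A \<beta>]
  have G: "mat_adjoint A * A \<in> carrier_mat n n" using A mat_adjoint_carrier[OF A] by simp
  have lt: "pick \<beta> a < n" if "a < card \<beta>" for a using pick_in_set_le[OF that] \<beta> by auto
  \<comment> \<open>Each entry of the Gram matrix depends only on two columns of \<open>A\<close>,
    so selecting rows and columns by \<beta> amounts to selecting columns of
    \<open>A\<close>.\<close>
  have "submatrix (mat_adjoint A * A) \<beta> \<beta> = mat_adjoint ?C * ?C"
  proof (rule eq_matI)
    note S = submatrix_carrier_subset[OF G \<beta> \<beta>]
    show "dim_row (submatrix (mat_adjoint A * A) \<beta> \<beta>) = dim_row (mat_adjoint ?C * ?C)"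
      "dim_col (submatrix (mat_adjoint A * A) \<beta> \<beta>) = dim_col (mat_adjoint ?C * ?C)"
      using S C(1) mat_adjoint_carrier[OF C(1)] by simp_all
    fix a b assume "a < dim_row (mat_adjoint ?C * ?C)" "b < dim_col (mat_adjoint ?C * ?C)"
    then have ab: "a < card \<beta>" "b < card \<beta>" using C(1) mat_adjoint_carrier[OF C(1)] by simp_all
    show "submatrix (mat_adjoint A * A) \<beta> \<beta> $$ (a, b) = (mat_adjoint ?C * ?C) $$ (a, b)"
      unfolding submatrix_index_subset[OF G \<beta> \<beta> ab] adjoint_mult_index[OF C(1) C(1) ab]
        adjoint_mult_index[OF A A lt[OF ab(1)] lt[OF ab(2)]]
      using C(2) ab by simp
  qed
  then show ?thesis by (simp add: principal_minor_def)
qed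

text \<open>Nonnegativity excludes cancellation, so one nonzero minor suffices; the columns from
  \<open>exists_rank_independent_cols\<close> supply it.\<close>

lemma sum_principal_minors_gram_nonzero:
  fixes A :: "complex mat"
  assumes A: "A \<in> carrier_mat m n"
  shows "(\<Sum>\<beta>\<in>index_sets (vec_space.rank m A) n. principal_minor (mat_adjoint A * A) \<beta>) \<noteq> 0"
proof
  let ?d = "principal_minor (mat_adjoint A * A)"
  let ?I = "index_sets (vec_space.rank m A) n"
  assume "sum ?d ?I = 0"
  moreover have "finite ?I" by (simp add: index_sets_def)
  moreover have "0 \<le> ?d \<beta>" if "\<beta> \<in> ?I" for \<beta>
  proof -
    have \<beta>: "\<beta> \<subseteq> {..<n}" using that by (simp add: index_sets_def)
    show ?thesis
      unfolding principal_minor_gram[OF A \<beta>]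
      by (rule det_gram_nonneg[OF submatrix_UNIV_cols(1)[OF A \<beta>]])
  qed
  ultimately have zero: "?d \<beta> = 0" if "\<beta> \<in> ?I" for \<beta>
    using that by (simp add: sum_nonneg_eq_0_iff)
  obtain \<beta> where \<beta>: "\<beta> \<subseteq> {..<n}" "card \<beta> = vec_space.rank m A"
    and ind: "\<And>v. v \<in> carrier_vec (card \<beta>) \<Longrightarrow> submatrix A UNIV \<beta> *\<^sub>v v = 0\<^sub>v m \<Longrightarrow> v = 0\<^sub>v (card \<beta>)"
    using exists_rank_independent_cols[OF A] by metis
  have "?d \<beta> = 0" using zero \<beta> by (simp add: index_sets_def)
  then show False
    unfolding principal_minor_gram[OF A \<beta>(1)]
    using det_gram_eq_0D[OF submatrix_UNIV_cols(1)[OF A \<beta>(1)]] ind by metis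
qed

text \<open>A dependency among the columns indexed by \<gamma>, extended by zeros, is a kernel
  vector of \<open>A\<close> orthogonal to every column of the replaced matrix. Its conjugate is
  therefore a left null vector of the submatrix.\<close>

lemma principal_minor_gram_replace_col_eq_0:
  fixes A :: "complex mat"
  assumes A: "A \<in> carrier_mat m n" and x: "x \<in> carrier_vec n"
    and orth: "\<And>z. z \<in> carrier_vec n \<Longrightarrow> A *\<^sub>v z = 0\<^sub>v m \<Longrightarrow> x \<bullet>c z = 0"
    and \<gamma>: "\<gamma> \<subseteq> {..<n}" and gt: "vec_space.rank m A < card \<gamma>"
  shows "principal_minor (replace_col (mat_adjoint A * A) x i) \<gamma> = 0"
proof -
  let ?k = "card \<gamma>" and ?C = "submatrix A UNIV \<gamma>" and ?G = "mat_adjoint A * A"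
  let ?R = "replace_col ?G x i"
  let ?S = "submatrix ?R \<gamma> \<gamma>"
  have G: "?G \<in> carrier_mat n n" using A mat_adjoint_carrier[OF A] by simp
  note R = replace_col_carrier[OF G, of x i]
  note S = submatrix_carrier_subset[OF R \<gamma> \<gamma>]
  note C = submatrix_UNIV_cols[OF A \<gamma>]
  obtain v where v: "v \<in> carrier_vec ?k" "v \<noteq> 0\<^sub>v ?k" "?C *\<^sub>v v = 0\<^sub>v m"
    using card_gt_rank_dependent_cols[OF A \<gamma> gt] .
  have pick: "bij_betw (pick \<gamma>) {..<?k} \<gamma>"
    using pick_bij_betw finite_subset[OF \<gamma>] by blast
  have lt: "pick \<gamma> a < n" if "a < ?k" for a using pick_in_set_le[OF that] \<gamma> by auto
  define z where
    "z = vec n (\<lambda>j. if j \<in> \<gamma> then v $ the_inv_into {..<?k} (pick \<gamma>) j else 0)"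
  have z: "z \<in> carrier_vec n" by (simp add: z_def)
  have z_pick: "z $ pick \<gamma> a = v $ a" if "a < ?k" for a
    using that lt pick_in_set_le[OF that] bij_betw_imp_inj_on[OF pick]
    by (simp add: z_def the_inv_into_f_f)
  \<comment> \<open>The function \<open>h\<close> will be the identity for the product with
    \<open>A\<close> and conjugation for inner products; \<open>h 0 = 0\<close> removes the
    positions outside \<gamma>.\<close>
  have sum_z: "(\<Sum>j<n. f j * h (z $ j)) = (\<Sum>a<?k. f (pick \<gamma> a) * h (v $ a))"
    if "h 0 = 0" for f and h :: "complex \<Rightarrow> complex"
  proof -
    have "(\<Sum>j<n. f j * h (z $ j)) = (\<Sum>j\<in>\<gamma>. f j * h (z $ j))"
      using \<gamma> that by (intro sum.mono_neutral_right) (auto simp: z_def)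
    also have "\<dots> = (\<Sum>a<?k. f (pick \<gamma> a) * h (v $ a))"
      by (subst sum.reindex_bij_betw[OF pick, symmetric]) (simp add: z_pick)
    finally show ?thesis .
  qed
  have Az: "A *\<^sub>v z = 0\<^sub>v m"
  proof (rule eq_vecI)
    fix l assume "l < dim_vec (0\<^sub>v m :: complex vec)"
    then have l: "l < m" by simp
    have "(A *\<^sub>v z) $ l = (\<Sum>j<n. A $$ (l, j) * z $ j)"
      using A z l by (simp add: scalar_prod_def atLeast0LessThan)
    also have "\<dots> = (\<Sum>a<?k. A $$ (l, pick \<gamma> a) * v $ a)"
      using sum_z[of "\<lambda>w. w"] by simp
    also have "\<dots> = (?C *\<^sub>v v) $ l"
      using C(1,2) v(1) l by (simp add: scalar_prod_def atLeast0LessThan)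
    finally show "(A *\<^sub>v z) $ l = 0\<^sub>v m $ l" by (simp add: v(3))
  qed (use A in simp)
  \<comment> \<open>The replaced column is \<open>x\<close>, covered by \<open>orth\<close>. Any
    other column is the adjoint of \<open>A\<close> applied to a column of \<open>A\<close>, and
    moving the adjoint across gives an inner product with \<open>A *\<^sub>v z = 0\<close>.\<close>
  have "col ?R c \<bullet>c z = 0" if c: "c < n" for c
  proof (cases "c = i")
    case True
    then have "col ?R c = x" using col_replace_col[OF G x c] by simp
    then show ?thesis using orth[OF z Az] by simp
  next
    case False
    then have "col ?R c = col ?G c" using col_replace_col[OF G x c] by simp
    also have "\<dots> = mat_adjoint A *\<^sub>v col A c" using col_mult2[OF mat_adjoint_carrier[OF A] A c] .
    finally show ?thesis
      using adjoint_mult_vec_cscalar[OF A _ z, of "col A c"] A c by (simp add: Az)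
  qed
  then have "(\<Sum>j<n. ?R $$ (j, c) * cnj (z $ j)) = 0" if "c < n" for c
    using that R z by (simp add: scalar_prod_def atLeast0LessThan)
  then have "(\<Sum>a<?k. ?R $$ (pick \<gamma> a, pick \<gamma> b) * cnj (v $ a)) = 0" if "b < ?k" for b
    using that lt sum_z[of cnj "\<lambda>j. ?R $$ (j, pick \<gamma> b)"] by simp
  then have "transpose_mat ?S *\<^sub>v conjugate v = 0\<^sub>v ?k"
    using S v(1) by (intro eq_vecI)
      (simp_all add: scalar_prod_def atLeast0LessThan submatrix_index_subset[OF R \<gamma> \<gamma>])
  moreover have "conjugate v \<in> carrier_vec ?k" "conjugate v \<noteq> 0\<^sub>v ?k"
    using v by (simp_all add: conjugate_zero_iff_vec)
  ultimately have "det (transpose_mat ?S) = 0"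
    using det_0_iff_vec_prod_zero[of "transpose_mat ?S" ?k] S by auto
  then show ?thesis using S by (simp add: principal_minor_def det_transpose)
qed

section \<open>Least squares solutions of minimal norm\<close>

text \<open>If the inner product \<open>c\<close> of \<open>f\<close> and \<open>g\<close> were
  nonzero, a small step from \<open>f\<close> along \<open>- c * g\<close> would decrease the sum of
  squares.\<close>

lemma sum_cmod_minimal_orthogonal:
  fixes f g :: "'a \<Rightarrow> complex"
  assumes min: "\<And>t. (\<Sum>a\<in>S. (cmod (f a))\<^sup>2) \<le> (\<Sum>a\<in>S. (cmod (f a + t * g a))\<^sup>2)"
  shows "(\<Sum>a\<in>S. f a * cnj (g a)) = 0"
proof -
  define c where "c = (\<Sum>a\<in>S. f a * cnj (g a))"
  define d where "d = (\<Sum>a\<in>S. (cmod (g a))\<^sup>2)"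
  have d: "0 \<le> d" by (simp add: d_def sum_nonneg)
  have sq: "(cmod (u + t * w))\<^sup>2 = (cmod u)\<^sup>2 + 2 * Re (cnj t * (u * cnj w)) + (cmod t)\<^sup>2 * (cmod w)\<^sup>2"
    for u t w
    unfolding cmod_power2 by (simp add: power2_eq_square algebra_simps)
  have key: "0 \<le> 2 * Re (cnj t * c) + (cmod t)\<^sup>2 * d" for t
    using min[of t] unfolding sq sum.distrib
    by (simp add: c_def d_def sum_distrib_left)
  \<comment> \<open>The step is \<open>t = - s * c\<close>. Dividing by \<open>d + 1\<close> is safe
    even when \<open>d = 0\<close>, and \<open>s * d \<le> 1\<close> keeps the quadratic term below
    the linear gain.\<close>
  define s where "s = 1 / (d + 1)"
  have s: "0 < s" "s * d \<le> 1" using d by (simp_all add: s_def)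
  have "0 \<le> 2 * Re (cnj (- of_real s * c) * c) + (cmod (- of_real s * c))\<^sup>2 * d"
    by (rule key)
  also have "\<dots> = s * (s * d - 2) * (cmod c)\<^sup>2"
  proof -
    have "Re (cnj (- of_real s * c) * c) = - s * (cmod c)\<^sup>2"
      unfolding cmod_power2 by (simp add: power2_eq_square algebra_simps)
    moreover have "(cmod (- of_real s * c))\<^sup>2 = s\<^sup>2 * (cmod c)\<^sup>2"
      by (simp add: norm_mult power_mult_distrib)
    ultimately show ?thesis by (simp add: power2_eq_square algebra_simps)
  qed
  finally have "0 \<le> s * (s * d - 2) * (cmod c)\<^sup>2" .
  moreover have "s * (s * d - 2) < 0" using s by (simp add: mult_less_0_iff)
  ultimately have "(cmod c)\<^sup>2 \<le> 0" by (metis mult_neg_pos not_le)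
  then show ?thesis by (simp add: c_def)
qed

text \<open>The Frobenius norm is the Euclidean norm of the entries over a rectangle of index pairs.
  This form serves both minimality conditions, that of the residual and that of the
  solution.\<close>

lemma frobenius_minimal_orthogonal:
  assumes C: "C \<in> carrier_mat p q" and D: "D \<in> carrier_mat p q"
    and min: "\<And>t. frobenius_norm C \<le> frobenius_norm (C + t \<cdot>\<^sub>m D)"
  shows "(\<Sum>i<p. \<Sum>j<q. C $$ (i, j) * cnj (D $$ (i, j))) = 0"
proof -
  have "(\<Sum>a\<in>{..<p} \<times> {..<q}. C $$ a * cnj (D $$ a)) = 0"
  proof (rule sum_cmod_minimal_orthogonal)
    fix t
    have "(\<Sum>i<p. \<Sum>j<q. (cmod (C $$ (i, j)))\<^sup>2)
        \<le> (\<Sum>i<p. \<Sum>j<q. (cmod (C $$ (i, j) + t * D $$ (i, j)))\<^sup>2)"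
      using min[of t] C D by (simp add: frobenius_norm_def)
    then show "(\<Sum>a\<in>{..<p} \<times> {..<q}. (cmod (C $$ a))\<^sup>2)
        \<le> (\<Sum>a\<in>{..<p} \<times> {..<q}. (cmod (C $$ a + t * D $$ a))\<^sup>2)"
      by (simp add: sum.cartesian_product case_prod_unfold)
  qed
  then show ?thesis by (simp add: sum.cartesian_product case_prod_unfold)
qed

text \<open>The minimal residual is orthogonal to every \<open>A * Y\<close>; matrix units
  \<open>Y\<close> read off the entries of the normal equations.\<close>

lemma least_squares_normal_equations:
  assumes A: "A \<in> carrier_mat m n" and B: "B \<in> carrier_mat m s"
    and X: "X \<in> least_squares_solutions A B"
  shows "mat_adjoint A * (A * X) = mat_adjoint A * B"
proof (rule eq_matI)
  note A' = mat_adjoint_carrier[OF A]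
  have Xc: "X \<in> carrier_mat n s" using X A B by (simp add: least_squares_solutions_def)
  show "dim_row (mat_adjoint A * (A * X)) = dim_row (mat_adjoint A * B)"
    "dim_col (mat_adjoint A * (A * X)) = dim_col (mat_adjoint A * B)"
    using Xc B by simp_all
  fix k j assume "k < dim_row (mat_adjoint A * B)" "j < dim_col (mat_adjoint A * B)"
  then have kj: "k < n" "j < s" using A' B by simp_all
  \<comment> \<open>With this matrix unit, \<open>A * Y\<close> has column \<open>k\<close> of
    \<open>A\<close> in position \<open>j\<close> and zeros elsewhere.\<close>
  define Y where "Y = mat n s (\<lambda>(a, b). if a = k \<and> b = j then (1::complex) else 0)"
  have Y: "Y \<in> carrier_mat n s" by (simp add: Y_def)
  have AY: "(A * Y) $$ (l, b) = (if b = j then A $$ (l, k) else 0)" if "l < m" "b < s" for l b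
    using that A kj by (simp add: Y_def scalar_prod_def if_distrib cong: if_cong)
  have "(\<Sum>l<m. \<Sum>b<s. (A * X - B) $$ (l, b) * cnj ((A * Y) $$ (l, b))) = 0"
  proof (rule frobenius_minimal_orthogonal)
    show "A * X - B \<in> carrier_mat m s" "A * Y \<in> carrier_mat m s" using A B Y by auto
    fix t
    have "A * (X + t \<cdot>\<^sub>m Y) - B = A * X - B + t \<cdot>\<^sub>m (A * Y)"
      using A B Xc Y
      by (intro eq_matI) (auto simp: mult_add_distrib_mat[of _ m n _ s] mult_smult_distrib[of _ m n _ s])
    moreover have "X + t \<cdot>\<^sub>m Y \<in> carrier_mat n s" using Xc Y by simp
    ultimately show "frobenius_norm (A * X - B) \<le> frobenius_norm (A * X - B + t \<cdot>\<^sub>m (A * Y))"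
      using X A B unfolding least_squares_solutions_def by force
  qed
  then have "(\<Sum>l<m. (A * X - B) $$ (l, j) * cnj (A $$ (l, k))) = 0"
    using kj by (simp add: AY if_distrib sum.delta cong: if_cong)
  then have "(\<Sum>l<m. cnj (A $$ (l, k)) * (A * X) $$ (l, j))
      - (\<Sum>l<m. cnj (A $$ (l, k)) * B $$ (l, j)) = 0"
    using A B Xc kj by (simp add: algebra_simps sum_subtractf)
  then show "(mat_adjoint A * (A * X)) $$ (k, j) = (mat_adjoint A * B) $$ (k, j)"
    using adjoint_mult_index[OF A _ kj, of "A * X"] adjoint_mult_index[OF A B kj] A Xc by simp
qed

text \<open>Adding to \<open>X\<close> a matrix that \<open>A\<close> annihilates leaves the
  residual unchanged, so minimality of the norm of \<open>X\<close> applies along that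
  direction.\<close>

lemma min_norm_least_squares_orthogonal:
  assumes A: "A \<in> carrier_mat m n" and B: "B \<in> carrier_mat m s"
    and X: "is_min_norm_least_squares_solution A B X"
    and z: "z \<in> carrier_vec n" "A *\<^sub>v z = 0\<^sub>v m" and j: "j < s"
  shows "col X j \<bullet>c z = 0"
proof -
  have XL: "X \<in> least_squares_solutions A B"
    and min: "\<And>Y. Y \<in> least_squares_solutions A B \<Longrightarrow> frobenius_norm X \<le> frobenius_norm Y"
    using X by (auto simp: is_min_norm_least_squares_solution_def)
  have Xc: "X \<in> carrier_mat n s" using XL A B by (simp add: least_squares_solutions_def)
  \<comment> \<open>Only column \<open>j\<close> carries \<open>z\<close>, so the Frobenius inner
    product with \<open>X\<close> reduces to \<open>col X j \<bullet>c z\<close>.\<close>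
  define Z where "Z = mat n s (\<lambda>(a, b). if b = j then z $ a else 0)"
  have Z: "Z \<in> carrier_mat n s" by (simp add: Z_def)
  have AZ: "A * Z = 0\<^sub>m m s"
  proof (rule eq_matI)
    fix l b assume "l < dim_row (0\<^sub>m m s :: complex mat)" "b < dim_col (0\<^sub>m m s :: complex mat)"
    then have lb: "l < m" "b < s" by simp_all
    have "col Z b = (if b = j then z else 0\<^sub>v n)"
      using z lb by (intro eq_vecI) (auto simp: Z_def)
    moreover have "row A l \<bullet> z = 0" using z(2) lb A by (metis carrier_matD(1) index_mult_mat_vec index_zero_vec(1))
    ultimately show "(A * Z) $$ (l, b) = 0\<^sub>m m s $$ (l, b)"
      using A Z lb by simp
  qed (use A Z in simp_all)
  have "(\<Sum>a<n. \<Sum>b<s. X $$ (a, b) * cnj (Z $$ (a, b))) = 0"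
  proof (rule frobenius_minimal_orthogonal[OF Xc Z], rule min)
    fix t
    have "A * (X + t \<cdot>\<^sub>m Z) = A * X"
      using A Xc Z by (simp add: mult_add_distrib_mat[of _ m n _ s] mult_smult_distrib[of _ m n _ s] AZ)
    then show "X + t \<cdot>\<^sub>m Z \<in> least_squares_solutions A B"
      using XL Xc Z A B unfolding least_squares_solutions_def by simp
  qed
  then show ?thesis
    using Xc z(1) j by (simp add: Z_def scalar_prod_def atLeast0LessThan if_distrib cong: if_cong)
qed

text \<open>One formula serves both cases of the theorem: the normal equations identify the inserted
  column, and orthogonality to the kernel removes the minors of order one above the rank.\<close>

lemma min_norm_least_squares_cramer:
  assumes A: "A \<in> carrier_mat m n" and B: "B \<in> carrier_mat m s"
    and X: "is_min_norm_least_squares_solution A B X" and i: "i < n" and j: "j < s"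
  shows "X $$ (i, j) =
    (\<Sum>\<beta>\<in>index_sets_containing (vec_space.rank m A) n i.
       principal_minor (replace_col (mat_adjoint A * A) (col (mat_adjoint A * B) j) i) \<beta>)
    / (\<Sum>\<beta>\<in>index_sets (vec_space.rank m A) n. principal_minor (mat_adjoint A * A) \<beta>)"
proof -
  let ?r = "vec_space.rank m A" and ?G = "mat_adjoint A * A" and ?x = "col X j"
  note A' = mat_adjoint_carrier[OF A]
  have XL: "X \<in> least_squares_solutions A B"
    using X by (simp add: is_min_norm_least_squares_solution_def)
  have Xc: "X \<in> carrier_mat n s" using XL A B by (simp add: least_squares_solutions_def)
  have G: "?G \<in> carrier_mat n n" using A A' by simp
  have x: "?x \<in> carrier_vec n" using Xc by auto
  have "?G *\<^sub>v ?x = col (?G * X) j" using col_mult2[OF G Xc j] by simp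
  also have "?G * X = mat_adjoint A * B"
    using least_squares_normal_equations[OF A B XL] assoc_mult_mat[OF A' A Xc] by simp
  finally have Gx: "?G *\<^sub>v ?x = col (mat_adjoint A * B) j" .
  have "(\<Sum>\<beta>\<in>index_sets_containing (Suc ?r) n i. principal_minor (replace_col ?G ?x i) \<beta>) = 0"
  proof (rule sum.neutral, rule ballI)
    fix \<beta> assume "\<beta> \<in> index_sets_containing (Suc ?r) n i"
    then show "principal_minor (replace_col ?G ?x i) \<beta> = 0"
      using principal_minor_gram_replace_col_eq_0[OF A x
          min_norm_least_squares_orthogonal[OF A B X _ _ j], of \<beta> i]
      by (auto simp: index_sets_containing_def index_sets_def)
  qed
  moreover have "?x $ i = X $$ (i, j)" using Xc i j by simp
  ultimately have "X $$ (i, j) * (\<Sum>\<beta>\<in>index_sets ?r n. principal_minor ?G \<beta>)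
    = (\<Sum>\<beta>\<in>index_sets_containing ?r n i.
         principal_minor (replace_col ?G (col (mat_adjoint A * B) j) i) \<beta>)"
    using sum_principal_minors_cramer[OF G x i vec_space.rank_le_nc[OF A]] unfolding Gx by simp
  then show ?thesis
    unfolding nonzero_eq_divide_eq[OF sum_principal_minors_gram_nonzero[OF A]] .
qed

theorem theorem3p2:
  fixes A B X :: "complex mat" and m n s :: nat
  assumes "A \<in> carrier_mat m n"
    and "B \<in> carrier_mat m s"
    and "is_min_norm_least_squares_solution A B X"
  shows "(vec_space.rank m A = n \<longrightarrow>
           (\<forall>i<n. \<forall>j<s.
             X $$ (i, j) =
               det (replace_col (mat_adjoint A * A) (col (mat_adjoint A * B) j) i)
                 / det (mat_adjoint A * A)))
       \<and> (\<forall>r. vec_space.rank m A = r \<and> 1 \<le> r \<and> r \<le> m \<and> m < n \<longrightarrow>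
           (\<forall>i<n. \<forall>j<s.
             X $$ (i, j) =
               (\<Sum>\<beta>\<in>index_sets_containing r n i.
                  principal_minor
                    (replace_col (mat_adjoint A * A) (col (mat_adjoint A * B) j) i) \<beta>)
                 / (\<Sum>\<beta>\<in>index_sets r n. principal_minor (mat_adjoint A * A) \<beta>)))"
proof -
  note cramer = min_norm_least_squares_cramer[OF assms]
  have G: "mat_adjoint A * A \<in> carrier_mat n n"
    using assms(1) mat_adjoint_carrier[OF assms(1)] by simp
  \<comment> \<open>At full column rank the only index set of size \<open>n\<close> is the whole
    range, so each sum collapses to a single determinant.\<close>
  have "\<beta> = {..<n}" if "\<beta> \<subseteq> {..<n}" "card \<beta> = n" for \<beta>
    using card_subset_eq[of "{..<n}" \<beta>] that by simp
  then have "index_sets n n = {{..<n}}" by (auto simp: index_sets_def)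
  moreover from this have "index_sets_containing n n i = {{..<n}}" if "i < n" for i
    using that by (auto simp: index_sets_containing_def)
  ultimately show ?thesis
    using cramer G by (simp add: principal_minor_lessThan replace_col_carrier)
qed

end
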